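(* Let $m$ be a positive integer and set $s=-2m$. Then for every integer $N\ge 2$, $$\mathcal{L}_s(N)=W_s\,N^2+2N^2\sum_{\substack{k=1\\ N\mid k}}^{m}(-1)^k\binom{2m}{m-k},$$ where the sum runs over those integers $k$ with $1\le k\le m$ that are divisible by $N$; in particular the sum vanishes if $N>m$.
   Context: For $s\in\mathbb{C}$, $s\ne 0$, and integers $N\ge 2$, the Riesz $s$-energy of the $N$th roots of unity is $$\mathcal{L}_s(N)=2^{-s}N\sum_{k=1}^{N-1}\Big(\sin\frac{\pi k}{N}\Big)^{-s}.$$ The constant $W_s$ is $$W_s=2^{-s}\,\frac{\Gamma((1-s)/2)}{\sqrt{\pi}\,\Gamma(1-s/2)}.$$ *)

theory Defs
  imports "HOL-Analysis.Analysis"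
begin

(* Intended for s \<noteq> 0 and N \<ge> 2.  For 1 \<le> k < N the sine is a positive real, so the
   principal-branch power agrees with the usual power of a positive real to a complex exponent. *)
definition riesz_energy :: "complex \<Rightarrow> nat \<Rightarrow> complex" where
  "riesz_energy s N =
     2 powr (- s) * of_nat N *
     (\<Sum>k = 1..N - 1. complex_of_real (sin (pi * real k / real N)) powr (- s))"

(* At positive even s the library convention Gamma = 0 at poles, with division by 0 being 0,
   gives the correct value 0.  At positive odd s the numerator has a genuine pole,
   and the value 0 carries no meaning. *)
definition riesz_W :: "complex \<Rightarrow> complex" where
  "riesz_W s =
     2 powr (- s) * (Gamma ((1 - s) / 2) / (complex_of_real (sqrt pi) * Gamma (1 - s / 2)))"

end

theory Submission
  imports Defs
begin

text \<open>
  With \<open>z = cis (2\<theta>)\<close> one has \<open>(2 sin \<theta>)\<^sup>2 = - (1 - z)\<^sup>2 / z\<close>, so the binomial theorem turns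
  \<open>(2 sin \<theta>)\<^bsup>2m\<^esup>\<close> into a Laurent polynomial in \<open>z\<close>. Summing over the \<open>N\<close>th roots of unity \<open>z\<close>
  retains, with weight \<open>N\<close>, only the coefficients of the powers \<open>z\<^bsup>j - m\<^esup>\<close> with \<open>N\<close> dividing \<open>j - m\<close>.
  The central one is the binomial coefficient of \<open>2m\<close> over \<open>m\<close>, which equals \<open>W\<^bsub>-2m\<^esub>\<close>, and the
  others pair up by symmetry.
\<close>

lemma four_sin_squared:
  "complex_of_real ((2 * sin \<theta>) ^ 2) = - ((1 - cis (2 * \<theta>)) ^ 2) / cis (2 * \<theta>)"
proof -
  have "- ((1 - cis (2 * \<theta>)) ^ 2) / cis (2 * \<theta>) = 2 - cis (2 * \<theta>) - cis (- (2 * \<theta>))"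
    by (simp add: field_simps power2_eq_square cis_mult flip: cis_inverse)
  also have "\<dots> = complex_of_real (2 - 2 * cos (2 * \<theta>))"
    by (simp add: complex_eq_iff)
  also have "2 - 2 * cos (2 * \<theta>) = (2 * sin \<theta>) ^ 2"
    by (simp add: cos_double_sin power_mult_distrib)
  finally show ?thesis by simp
qed

lemma two_sin_power_even:
  fixes m :: nat and \<theta> :: real
  defines "z \<equiv> cis (2 * \<theta>)"
  shows "complex_of_real ((2 * sin \<theta>) ^ (2 * m)) =
    (\<Sum>j\<le>2 * m. (- 1) ^ (m + j) * of_nat ((2 * m) choose j) * (z ^ j / z ^ m))"
proof -
  have "complex_of_real ((2 * sin \<theta>) ^ (2 * m)) = (- ((1 - z) ^ 2) / z) ^ m"
    by (simp only: power_mult of_real_power[of _ m] four_sin_squared z_def)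
  \<comment> \<open>The order \<open>- z + 1\<close> makes \<open>binomial_ring\<close> attach the
    power \<open>j\<close> to \<open>- z\<close>, whose sign then joins
    \<open>(- 1) ^ m\<close>.\<close>
  also have "\<dots> = (- 1) ^ m / z ^ m * (- z + 1) ^ (2 * m)"
    by (simp only: power_divide power_mult power_minus[of "(1 - z)\<^sup>2"]) simp
  also have "(- z + 1) ^ (2 * m) = (\<Sum>j\<le>2 * m. of_nat ((2 * m) choose j) * (- z) ^ j)"
    by (simp only: binomial_ring power_one mult_1_right)
  finally show ?thesis
    by (simp add: sum_distrib_left power_add power_minus[of z] mult_ac)
qed

text \<open>The summand is \<open>q ^ k\<close> for a fixed \<open>N\<close>th root of unity
  \<open>q\<close>, so the geometric sum vanishes unless \<open>q = 1\<close>.\<close>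

lemma sum_roots_of_unity_quotient:
  fixes N j m :: nat
  assumes "N \<ge> 1"
  shows "(\<Sum>k<N. cis (2 * (pi * real k / real N)) ^ j / cis (2 * (pi * real k / real N)) ^ m) =
    (if j mod N = m mod N then of_nat N else 0)"
proof -
  define \<zeta> where "\<zeta> i = exp (2 * of_real pi * \<i> * of_nat i / of_nat N)" for i :: nat
  define q where "q = \<zeta> j / \<zeta> m"
  \<comment> \<open>Exponent and index trade places, which makes the sum over \<open>k\<close>
    geometric.\<close>
  have pow: "cis (2 * (pi * real k / real N)) ^ i = \<zeta> i ^ k" for i k
    unfolding \<zeta>_def
    by (simp add: cis_conv_exp mult_ac flip: exp_of_nat_mult)
  have \<zeta>_N: "\<zeta> i ^ N = 1" for i
    unfolding \<zeta>_def by (rule complex_root_unity) (use assms in simp)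
  have q_1: "q = 1 \<longleftrightarrow> j mod N = m mod N"
    using complex_root_unity_eq[OF assms, of j m] by (simp add: q_def \<zeta>_def)
  have "(\<Sum>k<N. q ^ k) = (if q = 1 then of_nat N else 0)"
    using \<zeta>_N by (cases "q = 1") (simp_all add: geometric_sum, simp add: q_def power_divide)
  then show ?thesis
    unfolding pow q_1 by (simp add: q_def power_divide)
qed

text \<open>Prepares the pairing of the binomial coefficients at equal distance from the central
  one.\<close>

lemma sum_atMost_double_centered:
  fixes f :: "nat \<Rightarrow> 'a::comm_monoid_add"
  shows "(\<Sum>j\<le>2 * m. f j) = f m + (\<Sum>k=1..m. f (m - k) + f (m + k))"
proof -
  have "{..2 * m} = insert m ({..<m} \<union> {m<..2 * m})"
    by auto
  then have "(\<Sum>j\<le>2 * m. f j) = f m + ((\<Sum>j<m. f j) + (\<Sum>j\<in>{m<..2 * m}. f j))"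
    by (simp add: sum.union_disjoint disjoint_iff)
  also have "(\<Sum>j<m. f j) = (\<Sum>k=1..m. f (m - k))"
    by (rule sum.reindex_bij_witness[of _ "\<lambda>k. m - k" "\<lambda>k. m - k"]) auto
  also have "(\<Sum>j\<in>{m<..2 * m}. f j) = (\<Sum>k=1..m. f (m + k))"
    by (rule sum.reindex_bij_witness[of _ "\<lambda>k. m + k" "\<lambda>k. k - m"]) auto
  finally show ?thesis
    by (simp add: sum.distrib)
qed

lemma sum_two_sin_power_even:
  fixes m N :: nat
  assumes "N \<ge> 1"
  shows "(\<Sum>k<N. complex_of_real ((2 * sin (pi * real k / real N)) ^ (2 * m))) =
    of_nat N * (of_nat ((2 * m) choose m) +
      2 * (\<Sum>k | 1 \<le> k \<and> k \<le> m \<and> N dvd k. (- 1) ^ k * of_nat ((2 * m) choose (m - k))))"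
proof -
  define g :: "nat \<Rightarrow> complex" where
    "g j = (- 1) ^ (m + j) * of_nat ((2 * m) choose j) * (if j mod N = m mod N then of_nat N else 0)" for j
  define h :: "nat \<Rightarrow> complex" where "h k = (- 1) ^ k * of_nat ((2 * m) choose (m - k))" for k
  have g_pair: "g (m - k) + g (m + k) = (if N dvd k then 2 * of_nat N * h k else 0)"
    if "k \<in> {1..m}" for k
  proof -
    from that have k: "k \<le> m" by simp
    \<comment> \<open>As \<open>k \<le> m\<close>, the subtraction is not truncated and the two
      indices differ by exactly \<open>k\<close>.\<close>
    have dvd_minus: "(m - k) mod N = m mod N \<longleftrightarrow> N dvd k"
      using mod_eq_dvd_iff_nat[of "m - k" m N] k by (auto simp: eq_commute)
    have dvd_plus: "(m + k) mod N = m mod N \<longleftrightarrow> N dvd k"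
      using mod_eq_dvd_iff_nat[of m "m + k" N] by simp
    have "even (m + (m - k)) \<longleftrightarrow> even k"
      using k by simp
    then have sign_minus: "(- 1 :: complex) ^ (m + (m - k)) = (- 1) ^ k"
      by (simp add: uminus_power_if)
    have sign_plus: "(- 1 :: complex) ^ (m + (m + k)) = (- 1) ^ k"
      by (simp add: uminus_power_if)
    have "(2 * m) choose (m + k) = (2 * m) choose (m - k)"
      using binomial_symmetric[of "m + k" "2 * m"] k by simp
    then show ?thesis
      by (simp only: g_def h_def dvd_minus dvd_plus sign_minus sign_plus) simp
  qed
  have "(\<Sum>k<N. complex_of_real ((2 * sin (pi * real k / real N)) ^ (2 * m))) = (\<Sum>j\<le>2 * m. g j)"
    unfolding two_sin_power_even
    \<comment> \<open>With the sum over \<open>k\<close> innermost, the root-of-unity filter acts on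
      each Laurent coefficient separately.\<close>
    by (subst sum.swap)
       (simp only: g_def[abs_def] sum_roots_of_unity_quotient[OF assms] flip: sum_distrib_left)
  also have "\<dots> = g m + (\<Sum>k=1..m. if N dvd k then 2 * of_nat N * h k else 0)"
    by (simp only: sum_atMost_double_centered sum.cong[OF refl g_pair])
  also have "(\<Sum>k=1..m. if N dvd k then 2 * of_nat N * h k else 0) =
      2 * of_nat N * (\<Sum>k | k \<in> {1..m} \<and> N dvd k. h k)"
    by (simp add: sum.If_cases sum_distrib_left Int_def)
  also have "g m = of_nat N * of_nat ((2 * m) choose m)"
    by (simp add: g_def flip: mult_2)
  finally show ?thesis
    by (simp add: h_def algebra_simps)
qed

text \<open>The Gamma quotient is \<open>Gamma (1 / 2 + m) / (sqrt pi * m!)\<close>, that is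
  \<open>pochhammer (1 / 2) m / m!\<close>; the duplication formula \<open>fact_double\<close>
  absorbs the factor \<open>2 ^ (2 * m)\<close>.\<close>

lemma riesz_W_neg_even: "riesz_W (- 2 * of_nat m) = of_nat ((2 * m) choose m)"
proof -
  \<comment> \<open>\<open>pochhammer_Gamma\<close> needs an argument that is not a pole; the order
    on the reals settles this, and the fact is then transferred to the complex numbers.\<close>
  have "(1 / 2 :: real) \<notin> \<int>\<^sub>\<le>\<^sub>0"
    using nonpos_Ints_nonpos[of "1 / 2 :: real"] by auto
  then have half: "(1 / 2 :: complex) \<notin> \<int>\<^sub>\<le>\<^sub>0"
    by (simp flip: of_real_in_nonpos_Ints_iff[where 'a = complex])
  have Gamma_half: "Gamma (1 / 2 + of_nat m :: complex) = pochhammer (1 / 2) m * of_real (sqrt pi)"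
    using pochhammer_Gamma[OF half, of m] Gamma_one_half_complex
    by (simp add: field_simps)
  have "riesz_W (- 2 * of_nat m) = 2 ^ (2 * m) * (pochhammer (1 / 2) m / fact m)"
    using powr_nat'[of 2 "2 * m"]
    by (simp add: riesz_W_def add_divide_distrib Gamma_half Gamma_fact)
  also have "\<dots> = fact (2 * m) / (fact m * fact m)"
    by (simp add: fact_double)
  also have "\<dots> = of_nat ((2 * m) choose m)"
    by (simp add: binomial_fact)
  finally show ?thesis .
qed

text \<open>Adding the index \<open>k = 0\<close> costs nothing, since \<open>sin 0 = 0\<close> and
  the exponent \<open>2 * m\<close> is positive; the sum then runs over all \<open>N\<close>th roots
  of unity.\<close>

lemma riesz_energy_neg_even:
  assumes "m \<ge> 1" and "N \<ge> 1"
  shows "riesz_energy (- 2 * of_nat m) N =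
    of_nat N * (\<Sum>k<N. complex_of_real ((2 * sin (pi * real k / real N)) ^ (2 * m)))"
proof -
  \<comment> \<open>At \<open>z = 0\<close> both sides are 0 because
    \<open>m \<ge> 1\<close>.\<close>
  have powr_even: "z powr (2 * of_nat m) = z ^ (2 * m)" for z :: complex
    using powr_nat'[of z "2 * m"] assms by simp
  have "{..<N} = insert 0 {1..N - 1}"
    using assms by auto
  then have "(\<Sum>k<N. complex_of_real ((2 * sin (pi * real k / real N)) ^ (2 * m))) =
      (\<Sum>k=1..N - 1. complex_of_real ((2 * sin (pi * real k / real N)) ^ (2 * m)))"
    using assms by simp
  then show ?thesis
    by (simp add: riesz_energy_def powr_even power_mult_distrib sum_distrib_left mult.assoc
        mult.left_commute[of "of_nat N"])
qed

theorem theorem1: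
  fixes m N :: nat and s :: complex
  assumes "m \<ge> 1" and "s = - 2 * of_nat m" and "N \<ge> 2"
  shows "riesz_energy s N =
           riesz_W s * of_nat N ^ 2 +
           2 * of_nat N ^ 2 *
             (\<Sum>k | 1 \<le> k \<and> k \<le> m \<and> N dvd k. (- 1) ^ k * of_nat ((2 * m) choose (m - k)))
         \<and> (N > m \<longrightarrow>
             (\<Sum>k | 1 \<le> k \<and> k \<le> m \<and> N dvd k.
                (- 1) ^ k * of_nat ((2 * m) choose (m - k)) :: complex) = 0)"
proof (intro conjI impI)
  have N: "N \<ge> 1" using assms(3) by simp
  show "riesz_energy s N = riesz_W s * of_nat N ^ 2 + 2 * of_nat N ^ 2 *
      (\<Sum>k | 1 \<le> k \<and> k \<le> m \<and> N dvd k. (- 1) ^ k * of_nat ((2 * m) choose (m - k)))"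
    unfolding assms(2) riesz_W_neg_even riesz_energy_neg_even[OF assms(1) N]
      sum_two_sin_power_even[OF N]
    by (simp add: algebra_simps power2_eq_square)
next
  assume "N > m"
  \<comment> \<open>A positive multiple of \<open>N\<close> is at least \<open>N\<close>, hence
    exceeds \<open>m\<close>.\<close>
  then have no_terms: "{k. 1 \<le> k \<and> k \<le> m \<and> N dvd k} = {}"
    by (auto dest: dvd_imp_le)
  show "(\<Sum>k | 1 \<le> k \<and> k \<le> m \<and> N dvd k.
      (- 1) ^ k * of_nat ((2 * m) choose (m - k)) :: complex) = 0"
    unfolding no_terms by simp
qed

end
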